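(* Let $K\ge 1$ devices be given, with a fixed choice of slicing layers $l_1,\dots,l_K\in\{1,\dots,L\}$ and fixed transmission rates, and let $C_k$ (local processing plus transmission delay) and $F_k\ge 0$ (remaining server workload) be the resulting constants for $k=1,\dots,K$. Let $f_{\mathrm{max}}>0$ be the total server computational resource. Let $\mathcal{F}=\{k : F_k\neq 0\}$ and assume $\mathcal{F}\neq\emptyset$. Let $$m\in\underset{k\in\mathcal{F}}{\mathrm{argmin}}\,\{C_k\},\qquad \Delta c_{m,k}=C_m-C_k,\qquad f_b=\min_{k\in\mathcal{F},\,k\neq m}\left\{-\frac{F_m}{\Delta c_{m,k}}\right\},$$ where $-F_m/\Delta c_{m,k}$ is read as $+\infty$ if $\Delta c_{m,k}=0$, and the minimum over the empty set is $+\infty$. Then there exists a solution $x=f_{m,s}\in(0,f_b)$ of the equation $$f_{\mathrm{max}} = f_{m,s}+\sum_{k\in\mathcal{F},\,k\neq m}\frac{f_{m,s}F_k}{F_m+f_{m,s}\,\Delta c_{m,k}},$$ such that the allocation $$f_{k,s}=\frac{F_k f_{m,s}}{F_m+f_{m,s}\,\Delta c_{m,k}},\qquad k=1,\dots,K,\ k\ne m,\ k\in\mathcal{F},\qquad f_{k,s}=0\ \text{ for } k\notin\mathcal{F},$$ is a feasible server resource allocation (that is, $f_{k,s}>0$ for all $k\in\mathcal{F}$, and $\sum_{k=1}^K f_{k,s}=f_{\mathrm{max}}$) and is optimal: it minimizes the maximum inference delay $\max_{1\le k\le K} J_k$ over all feasible server resource allocations.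
   Context: There are $K$ devices and one central server. Each device $k$ runs a neural network made of $L$ modules with workloads $W_{k,1},\dots,W_{k,L}\ge 0$. Device $k$ has computational resource $f_k>0$ and transmission rate $R_k>0$ (fixed, since bandwidth is fixed). If device $k$ slices its network at module $l_k$, it processes modules $1,\dots,l_k$ locally, transmits an amount of data $D_{k,l_k}+\tau_{k,l_k}\ge 0$, and the server processes modules $l_k+1,\dots,L$ using computational resource $f_{k,s}$ allocated to device $k$. Define $$C_k=\frac{D_{k,l_k}+\tau_{k,l_k}}{R_k}+\frac{\sum_{j=1}^{l_k}W_{k,j}}{f_k},\qquad F_k=\sum_{j=l_k+1}^{L}W_{k,j}.$$ The server processes all devices in parallel. The inference delay of device $k$ is $J_k=C_k+F_k/f_{k,s}$, where the term $F_k/f_{k,s}$ is taken to be $0$ if $F_k=0$ (no server resources are needed, and $f_{k,s}=0$ is allowed). A feasible server resource allocation is a vector $(f_{1,s},\dots,f_{K,s})$ with $f_{k,s}\ge 0$ for all $k$, $f_{k,s}>0$ whenever $F_k\neq 0$, and $\sum_{k=1}^K f_{k,s}=f_{\mathrm{max}}$. *)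

theory Defs
  imports Complex_Main "HOL-Library.Extended_Real"
begin

text \<open>
  Devices are numbered \<open>1, \<dots>, K\<close> and the modules of each network \<open>1, \<dots>, L\<close>. Every device-indexed
  quantity is a function on \<open>nat\<close>, of which only the values at \<open>{1..K}\<close> matter.
\<close>

definition local_delay ::
  "(nat \<Rightarrow> nat \<Rightarrow> real) \<Rightarrow> (nat \<Rightarrow> nat \<Rightarrow> real) \<Rightarrow> (nat \<Rightarrow> nat \<Rightarrow> real) \<Rightarrow> (nat \<Rightarrow> real) \<Rightarrow> (nat \<Rightarrow> real)
    \<Rightarrow> (nat \<Rightarrow> nat) \<Rightarrow> nat \<Rightarrow> real" where
  "local_delay W D \<tau> R f l k = (D k (l k) + \<tau> k (l k)) / R k + (\<Sum>j = 1..l k. W k j) / f k"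

definition server_load :: "nat \<Rightarrow> (nat \<Rightarrow> nat \<Rightarrow> real) \<Rightarrow> (nat \<Rightarrow> nat) \<Rightarrow> nat \<Rightarrow> real" where
  "server_load L W l k = (\<Sum>j = l k + 1..L. W k j)"

definition inference_delay ::
  "(nat \<Rightarrow> real) \<Rightarrow> (nat \<Rightarrow> real) \<Rightarrow> (nat \<Rightarrow> real) \<Rightarrow> nat \<Rightarrow> real" where
  "inference_delay C F fs k = C k + (if F k = 0 then 0 else F k / fs k)"

definition max_delay ::
  "nat \<Rightarrow> (nat \<Rightarrow> real) \<Rightarrow> (nat \<Rightarrow> real) \<Rightarrow> (nat \<Rightarrow> real) \<Rightarrow> real" where
  "max_delay K C F fs = Max (inference_delay C F fs ` {1..K})"

definition feasible_allocation ::
  "nat \<Rightarrow> (nat \<Rightarrow> real) \<Rightarrow> real \<Rightarrow> (nat \<Rightarrow> real) \<Rightarrow> bool" where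
  "feasible_allocation K F fmax fs \<longleftrightarrow>
     (\<forall>k\<in>{1..K}. 0 \<le> fs k) \<and>
     (\<forall>k\<in>{1..K}. F k \<noteq> 0 \<longrightarrow> 0 < fs k) \<and>
     (\<Sum>k = 1..K. fs k) = fmax"

definition optimal_allocation ::
  "nat \<Rightarrow> (nat \<Rightarrow> real) \<Rightarrow> (nat \<Rightarrow> real) \<Rightarrow> real \<Rightarrow> (nat \<Rightarrow> real) \<Rightarrow> bool" where
  "optimal_allocation K C F fmax fs \<longleftrightarrow>
     is_arg_min (max_delay K C F) (feasible_allocation K F fmax) fs"

definition offloading_devices :: "nat \<Rightarrow> (nat \<Rightarrow> real) \<Rightarrow> nat set" where
  "offloading_devices K F = {k \<in> {1..K}. F k \<noteq> 0}"

definition delay_diff :: "(nat \<Rightarrow> real) \<Rightarrow> nat \<Rightarrow> nat \<Rightarrow> real" where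
  "delay_diff C m k = C m - C k"

text \<open>
  The infimum ranges over a finite index set, so it is a minimum when that set is nonempty and
  \<open>\<infinity>\<close> when it is empty. The zero case is split off because \<open>ereal\<close> division would
  give \<open>- F m / 0 = -\<infinity>\<close>.
\<close>

definition resource_bound ::
  "nat \<Rightarrow> (nat \<Rightarrow> real) \<Rightarrow> (nat \<Rightarrow> real) \<Rightarrow> nat \<Rightarrow> ereal" where
  "resource_bound K C F m =
     (INF k \<in> offloading_devices K F - {m}.
        if delay_diff C m k = 0 then \<infinity> else ereal (- (F m / delay_diff C m k)))"

definition candidate_allocation ::
  "nat \<Rightarrow> (nat \<Rightarrow> real) \<Rightarrow> (nat \<Rightarrow> real) \<Rightarrow> nat \<Rightarrow> real \<Rightarrow> nat \<Rightarrow> real" where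
  "candidate_allocation K C F m x k =
     (if k = m then x
      else if k \<in> offloading_devices K F then F k * x / (F m + x * delay_diff C m k)
      else 0)"

end

theory Submission
  imports Defs
begin

text \<open>
  Parametrise by the common delay \<open>T\<close> instead of \<open>x\<close>: giving \<open>F k / (T - C k)\<close> to every offloading
  device makes all their delays equal to \<open>T\<close>. On \<open>T > Max C\<close> the total demand is
  continuous, and the intermediate value theorem yields a \<open>T\<close> at which it equals \<open>fmax\<close>; then
  \<open>x = F m / (T - C m)\<close>, and \<open>x < f\<^sub>b\<close> says exactly that \<open>T > C k\<close> for all \<open>k\<close>. An allocation
  with a smaller maximal delay would give every offloading device strictly more, exceeding \<open>fmax\<close>.
\<close>

lemma exists_common_delay:
  fixes C F :: "'a \<Rightarrow> real" and c :: real
  assumes fin: "finite A" and ne: "A \<noteq> {}" and F: "\<And>k. k \<in> A \<Longrightarrow> 0 < F k" and c: "0 < c"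
  obtains T where "\<And>k. k \<in> A \<Longrightarrow> C k < T" and "(\<Sum>k\<in>A. F k / (T - C k)) = c"
proof -
  define M where "M = Max (C ` A)"
  have M: "C k \<le> M" if "k \<in> A" for k
    unfolding M_def using fin that by simp
  have "M \<in> C ` A"
    unfolding M_def using fin ne by (intro Max_in) auto
  then obtain j where j: "j \<in> A" "C j = M"
    by auto
  define S where "S = sum F A"
  have F_le_S: "F k \<le> S" if "k \<in> A" for k
    unfolding S_def using that fin F by (intro member_le_sum) (auto intro: less_imp_le)
  have S: "0 < S"
    using F[OF j(1)] F_le_S[OF j(1)] by linarith
  \<comment> \<open>The bracket for the intermediate value theorem. At \<open>a\<close> device
    \<open>j\<close> alone already demands \<open>F j / (a - C j) = c\<close>; at \<open>b\<close>
    every denominator is at least \<open>S / c\<close>, so the total is at most \<open>c\<close>.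
    Since \<open>M < a\<close>, no pole lies in the interval.\<close>
  define a where "a = M + F j / c"
  define b where "b = M + S / c"
  have Ma: "M < a"
    unfolding a_def using F[OF j(1)] c by simp
  have ab: "a \<le> b"
    unfolding a_def b_def using F_le_S[OF j(1)] c by (simp add: divide_right_mono)
  let ?G = "\<lambda>T. \<Sum>k\<in>A. F k / (T - C k)"
  have "c \<le> ?G a"
  proof -
    have "c = F j / (a - C j)"
      using j F[OF j(1)] c by (simp add: a_def)
    also have "\<dots> \<le> ?G a"
    proof (rule member_le_sum[OF j(1) _ fin])
      fix k assume "k \<in> A - {j}"
      then show "0 \<le> F k / (a - C k)"
        using F[of k] M[of k] Ma by (intro divide_nonneg_nonneg) auto
    qed
    finally show ?thesis .
  qed
  moreover have "?G b \<le> c"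
  proof -
    have "?G b \<le> (\<Sum>k\<in>A. F k / (S / c))"
    proof (rule sum_mono)
      fix k assume k: "k \<in> A"
      show "F k / (b - C k) \<le> F k / (S / c)"
        using F[OF k] M[OF k] S c by (intro frac_le) (auto simp: b_def)
    qed
    also have "\<dots> = c"
      using S by (simp add: S_def sum_divide_distrib[symmetric] sum_distrib_right[symmetric])
    finally show ?thesis .
  qed
  moreover have "continuous_on {a..b} ?G"
    using M Ma by (intro continuous_intros) force
  ultimately obtain T where "a \<le> T" "?G T = c"
    using IVT2'[of ?G b c a] ab by auto
  then show thesis
    using M Ma by (intro that[of T]) force+
qed

lemma max_delay_less_iff:
  assumes "1 \<le> K"
  shows "max_delay K C F g < t \<longleftrightarrow> (\<forall>k\<in>{1..K}. inference_delay C F g k < t)"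
  unfolding max_delay_def using assms by (subst Max_less_iff) auto

text \<open>Equal delays \<open>T\<close> force any better allocation to give more to each
  offloading device, and \<open>zero\<close> ensures that it cannot save on the other devices.
  \<open>T\<close> need not be the maximal delay here: a device without server load may have a
  larger \<open>C\<close>.\<close>

lemma optimal_allocation_if_equal_delays:
  assumes K: "1 \<le> K"
    and F: "\<And>k. k \<in> {1..K} \<Longrightarrow> 0 \<le> F k"
    and feas: "feasible_allocation K F fmax g"
    and eq: "\<And>k. k \<in> offloading_devices K F \<Longrightarrow> C k + F k / g k = T"
    and zero: "\<And>k. k \<in> {1..K} \<Longrightarrow> F k = 0 \<Longrightarrow> g k = 0"
  shows "optimal_allocation K C F fmax g"
  unfolding optimal_allocation_def is_arg_min_def
proof (intro conjI notI feas)
  assume "\<exists>h. feasible_allocation K F fmax h \<and> max_delay K C F h < max_delay K C F g"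
  then obtain h where h: "feasible_allocation K F fmax h"
    and less: "max_delay K C F h < max_delay K C F g"
    by auto
  have "max_delay K C F g \<in> inference_delay C F g ` {1..K}"
    unfolding max_delay_def using K by (intro Max_in) auto
  then obtain j where j: "j \<in> {1..K}" and g_j: "max_delay K C F g = inference_delay C F g j"
    by auto
  have h_less: "inference_delay C F h k < inference_delay C F g j" if "k \<in> {1..K}" for k
    using less that unfolding max_delay_less_iff[OF K] g_j by blast
  \<comment> \<open>Without server load the delay of \<open>j\<close> would be \<open>C j\<close>
    under \<open>h\<close> as well, so it could not drop. Hence the maximum under \<open>g\<close>
    is attained at an offloading device and equals \<open>T\<close>.\<close>
  have "F j \<noteq> 0"
    using h_less[OF j] by (auto simp: inference_delay_def)
  then have T: "inference_delay C F g j = T"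
    using eq[of j] j by (simp add: inference_delay_def offloading_devices_def)
  have g_less: "g k < h k" if "k \<in> {1..K}" "F k \<noteq> 0" for k
  proof -
    have "0 < F k" "0 < g k" "0 < h k"
      using that F[of k] feas h by (auto simp: feasible_allocation_def)
    moreover have "F k / h k < F k / g k"
      using h_less[OF that(1)] eq[of k] that unfolding T
      by (simp add: inference_delay_def offloading_devices_def)
    ultimately show ?thesis
      by (simp add: divide_simps)
  qed
  have "sum g {1..K} < sum h {1..K}"
  proof (rule sum_strict_mono_ex1)
    show "\<forall>k\<in>{1..K}. g k \<le> h k"
      using g_less zero h unfolding feasible_allocation_def by (metis less_imp_le)
    show "\<exists>k\<in>{1..K}. g k < h k"
      using g_less[OF j \<open>F j \<noteq> 0\<close>] j by blast
  qed simp
  then show False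
    using feas h by (simp add: feasible_allocation_def)
qed

theorem lemma1:
  fixes K L :: nat
    and W D \<tau> :: "nat \<Rightarrow> nat \<Rightarrow> real"
    and R f C F :: "nat \<Rightarrow> real"
    and l :: "nat \<Rightarrow> nat"
    and fmax :: real
    and m :: nat
  assumes "K \<ge> 1"
    and "\<And>k j. k \<in> {1..K} \<Longrightarrow> j \<in> {1..L} \<Longrightarrow> W k j \<ge> 0"
    and "\<And>k. k \<in> {1..K} \<Longrightarrow> f k > 0"
    and "\<And>k. k \<in> {1..K} \<Longrightarrow> R k > 0"
    and "\<And>k. k \<in> {1..K} \<Longrightarrow> l k \<in> {1..L}"
    and "\<And>k. k \<in> {1..K} \<Longrightarrow> D k (l k) + \<tau> k (l k) \<ge> 0"
    and "C = local_delay W D \<tau> R f l"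
    and "F = server_load L W l"
    and "fmax > 0"
    and "offloading_devices K F \<noteq> {}"
    and "is_arg_min C (\<lambda>k. k \<in> offloading_devices K F) m"
  shows "\<exists>x. 0 < x \<and> ereal x < resource_bound K C F m \<and>
           fmax = x + (\<Sum>k \<in> offloading_devices K F - {m}. x * F k / (F m + x * delay_diff C m k)) \<and>
           feasible_allocation K F fmax (candidate_allocation K C F m x) \<and>
           optimal_allocation K C F fmax (candidate_allocation K C F m x)"
proof -
  let ?O = "offloading_devices K F"
  have F_nonneg: "0 \<le> F k" if "k \<in> {1..K}" for k
    unfolding assms(8) server_load_def using that by (intro sum_nonneg assms(2)) auto
  have O_sub: "?O \<subseteq> {1..K}" and fin: "finite ?O"
    by (auto simp: offloading_devices_def)
  have F_pos: "0 < F k" if "k \<in> ?O" for k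
    using that F_nonneg[of k] by (auto simp: offloading_devices_def)
  have m: "m \<in> ?O" and C_min: "\<And>k. k \<in> ?O \<Longrightarrow> C m \<le> C k"
    using assms(11) by (auto simp: is_arg_min_linorder)
  obtain T where T: "\<And>k. k \<in> ?O \<Longrightarrow> C k < T" and total: "(\<Sum>k\<in>?O. F k / (T - C k)) = fmax"
    using exists_common_delay[where C = C and F = F, OF fin assms(10) F_pos assms(9)] by blast
  define x where "x = F m / (T - C m)"
  have x: "0 < x"
    using F_pos[OF m] T[OF m] by (simp add: x_def)
  have Fm: "F m = x * (T - C m)"
    using T[OF m] by (simp add: x_def)
  \<comment> \<open>The factor \<open>x\<close> cancels in the candidate formula and leaves
    \<open>F k / (T - C k)\<close>; for \<open>k = m\<close> this is \<open>x\<close>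
    itself.\<close>
  have denom: "F m + x * delay_diff C m k = x * (T - C k)" for k
    by (simp add: Fm delay_diff_def algebra_simps)
  let ?g = "candidate_allocation K C F m x"
  have g: "?g k = F k / (T - C k)" if "k \<in> ?O" for k
    using x that by (auto simp: candidate_allocation_def denom x_def[symmetric])
  have g_zero: "?g k = 0" if "k \<notin> ?O" for k
    using m that by (auto simp: candidate_allocation_def)
  have g_pos: "0 < ?g k" if "k \<in> ?O" for k
    using F_pos[OF that] T[OF that] by (simp add: g[OF that])
  have "ereal x < resource_bound K C F m"
  proof -
    have bound: "ereal x < (if delay_diff C m k = 0 then \<infinity> else ereal (- (F m / delay_diff C m k)))"
      if k: "k \<in> ?O" for k
    proof (cases "delay_diff C m k = 0")
      case False
      then have "delay_diff C m k < 0"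
        using C_min[OF k] by (simp add: delay_diff_def)
      \<comment> \<open>Dividing by the negative \<open>delay_diff C m k\<close> reverses the
        inequality and gives the bound on \<open>x\<close>.\<close>
      moreover have "0 < F m + x * delay_diff C m k"
        unfolding denom using x T[OF k] by simp
      ultimately show ?thesis
        by (simp add: field_simps)
    qed simp
    show ?thesis
    \<comment> \<open>The empty infimum is \<infinity>; a nonempty finite one is attained, so the
      strict inequality survives.\<close>
    proof (cases "?O - {m} = {}")
      case True
      then show ?thesis
        unfolding resource_bound_def by (simp only: image_empty Inf_empty) (simp add: top_ereal_def)
    next
      case False
      then show ?thesis
        unfolding resource_bound_def using fin bound by (subst finite_less_Inf_iff) blast+
    qed
  qed
  moreover have "fmax = x + (\<Sum>k\<in>?O - {m}. x * F k / (F m + x * delay_diff C m k))"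
    using x total sum.remove[OF fin m, of "\<lambda>k. F k / (T - C k)"] by (simp add: denom x_def[symmetric])
  moreover have feas: "feasible_allocation K F fmax ?g"
  proof -
    have "sum ?g {1..K} = sum ?g ?O"
      using O_sub g_zero by (intro sum.mono_neutral_right) auto
    also have "\<dots> = fmax"
      using g total by simp
    moreover have "0 \<le> ?g k" for k
      using g_pos[of k] g_zero[of k] by (cases "k \<in> ?O") auto
    ultimately show ?thesis
      using g_pos by (auto simp: feasible_allocation_def offloading_devices_def)
  qed
  moreover have "optimal_allocation K C F fmax ?g"
  proof (rule optimal_allocation_if_equal_delays[OF assms(1) F_nonneg feas])
    fix k assume k: "k \<in> ?O"
    show "C k + F k / ?g k = T"
      using F_pos[OF k] T[OF k] by (simp add: g[OF k])
  next
    fix k assume "F k = 0"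
    then show "?g k = 0"
      by (intro g_zero) (simp add: offloading_devices_def)
  qed
  ultimately show ?thesis
    using x by blast
qed

end
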